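(* Let $(\mathcal{B}_t,\mathcal{L}_t,\mathbf{P})$ be a market for liquidity at time $t$ and let $i\in\mathcal{L}_t$, $j\in\mathcal{B}_t$ denote lenders and borrowers. Under the bilateral contracting mechanism, any matching $\mu_t$ such that $r_{ij}<\bar r_j$ for any $\mu_t(i)=j$ and $r_{ij}<r_{kj}$ for any (such matched pair and any) $k\in\mathcal{L}_t$ with $\mu_t(k)=k$ is stable, i.e. $\mu^*_t=\mu_t$ is a stable matching. Denote by $\mathcal{EQ}_t$ the set of such equilibria. Moreover, the trading volume at time $t$ is bounded as follows: $\mathrm{Vol}(\mu_t^* )\le\min(|\mathcal{B}_t|,|\mathcal{L}_t|)$.
   Context: **Market.** $\mathcal{N}$ is a finite set of banks; $\mathcal{L}_t,\mathcal{B}_t\subseteq\mathcal{N}$ are disjoint sets (potential lenders and potential borrowers); $\mathbf{P}$ is the collection of all preference lists described below. Each lender $i$ has a base rate $r_i$, and the $r_i$ are strictly ordered (pairwise distinct). Each borrower $j$ has a reservation rate $\bar r_j$ and a default probability $\rho_j\in[0,1)$ on a loan of maturity $S\in\{1,2,\dots\}$ periods. All these quantities are given and commonly known. **Bilateral contracting mechanism.** The risk premium is $h_{ij}=\frac{1+r_i}{(1-\rho_j)^{1/S}}-1-r_i$, and the rate paid by $j$ when borrowing from $i$ is $r_{ij}=r_i+h_{ij}$. **Preferences.** Borrower $j$ prefers an option with a lower rate, where the option "borrow from lender $i$" has rate $r_{ij}$ and the option "stay unmatched" (denoted $j$) has rate $\bar r_j$. Every lender is indifferent among all borrowers. **Matching.**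 A matching $\mu_t$ is a one-to-one correspondence from $\mathcal{N}$ onto itself with $\mu_t(\mu_t(a))=a$ for all $a$, such that for any $b\in\mathcal{B}_t$, if $\mu_t(b)\neq b$ then $\mu_t(b)\in\mathcal{L}_t$, and for any $l\in\mathcal{L}_t$, if $\mu_t(l)\neq l$ then $\mu_t(l)\in\mathcal{B}_t$. A bank $a$ with $\mu_t(a)=a$ is unmatched. The volume is $\mathrm{Vol}(\mu_t)=\frac12\sum_{i\in\mathcal{L}_t\cup\mathcal{B}_t}\mathbf{1}\{\mu_t(i)\neq i\}$. **Stable matching.** A matching $\mu^*$ is stable if: (I) (pairwise deviation) for all $i,l\in\mathcal{L}_t$ and $k,j\in\mathcal{B}_t$ such that $\mu^*(i)=j$ and $\mu^*(k)=l$, it cannot be that both $i$ strictly prefers $k$ to $j$ and $k$ strictly prefers $i$ to $l$; (II) (coalitional deviation) let $\vec b\subseteq\mathcal{B}_t$ be a set of borrowers such that their assigned lenders are indifferent between any borrowers in $\vec b$ (for any $j,k\in\vec b$, lender $\mu^*(j)$ is indifferent between $j$ and $k$); then there cannot be another matching $\mu'$ such that every $j\in\vec b$ strictly prefers $\mu'(j)$ to $\mu^*(j)$ (this condition expresses that no group of borrowing banks can agree to swap counter-parties if their lenders are indifferent); (III) (unilateral deviation) for any $j\in\mathcal{B}_t$ with $\mu^*(j)\neq j$, it cannot be that $j$ strictly prefers staying unmatched to $\mu^*(j)$; and for any $j\in\mathcal{B}_t$, it cannot be that $j$ strictly prefers to $\mu^*(j)$ some $k\in\mathcal{L}_t$ with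 $\mu^*(k)=k$.
   Formalization: Added assumption: an unmatched borrower's reservation rate is at most the rate of every unmatched lender (else (III) can fail). In (II), the group is a nonempty set of matched borrowers and the new matching only swaps the group's own lenders (else any two matched pairs violate (II)). *)

theory Defs
  imports Complex_Main "HOL-Combinatorics.Permutations"
begin

text \<open>
  A market at a fixed time: \<open>N\<close> is the set of all banks, \<open>L\<close> and \<open>B\<close> the potential lenders and
  borrowers, \<open>r\<close> the lenders' base rates, \<open>\<rho>\<close> the borrowers' default probabilities, and \<open>S\<close> the
  maturity in periods. The borrowers' reservation rates \<open>rbar\<close> are arbitrary reals, so they do not
  occur among the market assumptions.
\<close>

locale liquidity_market =
  fixes N L B :: "'a set"
    and r \<rho> :: "'a \<Rightarrow> real"
    and S :: nat
  assumes finite_banks: "finite N"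
    and lenders: "L \<subseteq> N"
    and borrowers: "B \<subseteq> N"
    and disjoint: "L \<inter> B = {}"
    and base_rates_distinct: "inj_on r L"
    and default_prob: "j \<in> B \<Longrightarrow> 0 \<le> \<rho> j \<and> \<rho> j < 1"
    and maturity: "1 \<le> S"

definition risk_premium :: "('a \<Rightarrow> real) \<Rightarrow> ('a \<Rightarrow> real) \<Rightarrow> nat \<Rightarrow> 'a \<Rightarrow> 'a \<Rightarrow> real" where
  "risk_premium r \<rho> S i j = (1 + r i) / ((1 - \<rho> j) powr (1 / real S)) - 1 - r i"

definition loan_rate :: "('a \<Rightarrow> real) \<Rightarrow> ('a \<Rightarrow> real) \<Rightarrow> nat \<Rightarrow> 'a \<Rightarrow> 'a \<Rightarrow> real" where
  "loan_rate r \<rho> S i j = r i + risk_premium r \<rho> S i j"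

definition option_rate ::
  "('a \<Rightarrow> real) \<Rightarrow> ('a \<Rightarrow> real) \<Rightarrow> ('a \<Rightarrow> real) \<Rightarrow> nat \<Rightarrow> 'a \<Rightarrow> 'a \<Rightarrow> real" where
  "option_rate r rbar \<rho> S j x = (if x = j then rbar j else loan_rate r \<rho> S x j)"

text \<open>
  \<open>P a x y\<close> reads: for bank \<open>a\<close>, option \<open>x\<close> is at least as good as option \<open>y\<close>. The option of
  staying unmatched is the bank itself.
\<close>

type_synonym 'a preferences = "'a \<Rightarrow> 'a \<Rightarrow> 'a \<Rightarrow> bool"

definition strictly_prefers :: "'a preferences \<Rightarrow> 'a \<Rightarrow> 'a \<Rightarrow> 'a \<Rightarrow> bool" where
  "strictly_prefers P a x y \<longleftrightarrow> P a x y \<and> \<not> P a y x"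

definition indifferent :: "'a preferences \<Rightarrow> 'a \<Rightarrow> 'a \<Rightarrow> 'a \<Rightarrow> bool" where
  "indifferent P a x y \<longleftrightarrow> P a x y \<and> P a y x"

text \<open>
  A lender's preferences only compare borrowers: how a lender ranks staying unmatched is left open
  and plays no role in stability.
\<close>

definition contracting_preferences ::
  "'a set \<Rightarrow> 'a set \<Rightarrow> ('a \<Rightarrow> real) \<Rightarrow> ('a \<Rightarrow> real) \<Rightarrow> ('a \<Rightarrow> real) \<Rightarrow> nat \<Rightarrow> 'a preferences" where
  "contracting_preferences L B r rbar \<rho> S a x y \<longleftrightarrow>
     a \<in> B \<and> x \<in> insert a L \<and> y \<in> insert a L \<and>
       option_rate r rbar \<rho> S a x \<le> option_rate r rbar \<rho> S a y
     \<or> a \<in> L \<and> x \<in> B \<and> y \<in> B"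

definition is_matching :: "'a set \<Rightarrow> 'a set \<Rightarrow> 'a set \<Rightarrow> ('a \<Rightarrow> 'a) \<Rightarrow> bool" where
  "is_matching N L B \<mu> \<longleftrightarrow>
     \<mu> permutes N \<and> (\<forall>a\<in>N. \<mu> (\<mu> a) = a) \<and>
     (\<forall>b\<in>B. \<mu> b \<noteq> b \<longrightarrow> \<mu> b \<in> L) \<and>
     (\<forall>l\<in>L. \<mu> l \<noteq> l \<longrightarrow> \<mu> l \<in> B)"

definition volume :: "'a set \<Rightarrow> 'a set \<Rightarrow> ('a \<Rightarrow> 'a) \<Rightarrow> real" where
  "volume L B \<mu> = 1 / 2 * (\<Sum>i\<in>L \<union> B. of_bool (\<mu> i \<noteq> i))"

definition pairwise_stable :: "'a set \<Rightarrow> 'a set \<Rightarrow> 'a preferences \<Rightarrow> ('a \<Rightarrow> 'a) \<Rightarrow> bool" where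
  "pairwise_stable L B P \<mu> \<longleftrightarrow>
     (\<forall>i\<in>L. \<forall>l\<in>L. \<forall>k\<in>B. \<forall>j\<in>B. \<mu> i = j \<and> \<mu> k = l \<longrightarrow>
        \<not> (strictly_prefers P i k j \<and> strictly_prefers P k i l))"

text \<open>
  A coalitional deviation is a swap of counterparties inside a nonempty group \<open>b\<close> of borrowers that
  have a lender: \<open>\<mu>'\<close> hands out to \<open>b\<close> the very lenders that \<open>\<mu>\<close> assigns to \<open>b\<close>, and is otherwise
  unrestricted. Without the condition on images a single borrower could simply
  take over a cheaper lender that is matched to somebody outside the group.
\<close>

definition coalition_stable ::
  "'a set \<Rightarrow> 'a set \<Rightarrow> 'a set \<Rightarrow> 'a preferences \<Rightarrow> ('a \<Rightarrow> 'a) \<Rightarrow> bool" where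
  "coalition_stable N L B P \<mu> \<longleftrightarrow>
     (\<forall>b. b \<noteq> {} \<and> b \<subseteq> B \<and> \<mu> ` b \<subseteq> L \<and> (\<forall>j\<in>b. \<forall>k\<in>b. indifferent P (\<mu> j) j k) \<longrightarrow>
        \<not> (\<exists>\<mu>'. is_matching N L B \<mu>' \<and> \<mu>' ` b = \<mu> ` b \<and>
                (\<forall>j\<in>b. strictly_prefers P j (\<mu>' j) (\<mu> j))))"

definition unilaterally_stable :: "'a set \<Rightarrow> 'a set \<Rightarrow> 'a preferences \<Rightarrow> ('a \<Rightarrow> 'a) \<Rightarrow> bool" where
  "unilaterally_stable L B P \<mu> \<longleftrightarrow>
     (\<forall>j\<in>B. \<mu> j \<noteq> j \<longrightarrow> \<not> strictly_prefers P j j (\<mu> j)) \<and>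
     (\<forall>j\<in>B. \<not> (\<exists>k\<in>L. \<mu> k = k \<and> strictly_prefers P j k (\<mu> j)))"

definition stable_matching ::
  "'a set \<Rightarrow> 'a set \<Rightarrow> 'a set \<Rightarrow> 'a preferences \<Rightarrow> ('a \<Rightarrow> 'a) \<Rightarrow> bool" where
  "stable_matching N L B P \<mu> \<longleftrightarrow>
     is_matching N L B \<mu> \<and> pairwise_stable L B P \<mu> \<and>
     coalition_stable N L B P \<mu> \<and> unilaterally_stable L B P \<mu>"

text \<open>
  All stable matchings, not only those that meet some particular sufficient condition.
\<close>

definition equilibria :: "'a set \<Rightarrow> 'a set \<Rightarrow> 'a set \<Rightarrow> 'a preferences \<Rightarrow> ('a \<Rightarrow> 'a) set" where
  "equilibria N L B P = {\<mu>. stable_matching N L B P \<mu>}"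

end

(*
  Discounting by the default probability of a fixed borrower is strictly increasing in the lender's
  base rate, so all borrowers rank lenders by base rate. In a group that permutes its lenders, the
  borrower who holds the cheapest of them cannot gain. Lenders never strictly prefer one borrower
  to another, which rules out pairwise deviations. The volume bound holds because a matching pairs
  the matched lenders with the matched borrowers bijectively.
*)
theory Submission
  imports Defs
begin

context liquidity_market
begin

text \<open>The two occurrences of \<open>r i\<close> in the loan rate cancel, leaving
  \<open>(1 + r i) / d - 1\<close>, where the divisor \<open>d\<close> depends on \<open>j\<close>
  alone and is positive because \<open>\<rho> j < 1\<close>.\<close>

lemma loan_rate_le_iff:
  assumes "j \<in> B"
  shows "loan_rate r \<rho> S i j \<le> loan_rate r \<rho> S k j \<longleftrightarrow> r i \<le> r k"
proof -
  have "0 < (1 - \<rho> j) powr (1 / real S)"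
    using default_prob[OF assms] by simp
  then show ?thesis
    by (simp add: loan_rate_def risk_premium_def divide_le_cancel)
qed

lemma strictly_prefers_lender_iff:
  assumes "j \<in> B" and "i \<in> L" and "k \<in> L"
  shows "strictly_prefers (contracting_preferences L B r rbar \<rho> S) j i k \<longleftrightarrow>
    loan_rate r \<rho> S i j < loan_rate r \<rho> S k j"
proof -
  have "i \<noteq> j" "k \<noteq> j" "j \<notin> L"
    using assms disjoint by auto
  with assms show ?thesis
    by (auto simp: strictly_prefers_def contracting_preferences_def option_rate_def)
qed

lemma strictly_prefers_unmatched_iff:
  assumes "j \<in> B" and "i \<in> L"
  shows "strictly_prefers (contracting_preferences L B r rbar \<rho> S) j j i \<longleftrightarrow>
    rbar j < loan_rate r \<rho> S i j"
    and "strictly_prefers (contracting_preferences L B r rbar \<rho> S) j i j \<longleftrightarrow>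
    loan_rate r \<rho> S i j < rbar j"
proof -
  have "i \<noteq> j" "j \<notin> L"
    using assms disjoint by auto
  with assms show
    "strictly_prefers (contracting_preferences L B r rbar \<rho> S) j j i \<longleftrightarrow>
      rbar j < loan_rate r \<rho> S i j"
    "strictly_prefers (contracting_preferences L B r rbar \<rho> S) j i j \<longleftrightarrow>
      loan_rate r \<rho> S i j < rbar j"
    by (auto simp: strictly_prefers_def contracting_preferences_def option_rate_def)
qed

lemma pairwise_stable_contracting:
  "pairwise_stable L B (contracting_preferences L B r rbar \<rho> S) \<mu>"
  by (auto simp: pairwise_stable_def strictly_prefers_def contracting_preferences_def)

lemma coalition_stable_contracting:
  "coalition_stable N L B (contracting_preferences L B r rbar \<rho> S) \<mu>"
  unfolding coalition_stable_def
proof (intro allI impI notI; elim conjE exE)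
  fix b \<mu>'
  assume b: "b \<noteq> {}" "b \<subseteq> B" "\<mu> ` b \<subseteq> L" and image: "\<mu>' ` b = \<mu> ` b"
    and better: "\<forall>j\<in>b. strictly_prefers (contracting_preferences L B r rbar \<rho> S) j (\<mu>' j) (\<mu> j)"
  have "finite b"
    using b borrowers finite_banks by (meson finite_subset)
  \<comment> \<open>The minimum is taken over base rates, which do not depend on the borrower; loan
    rates of different borrowers would not be comparable.\<close>
  then obtain j where j: "j \<in> b" and least: "\<And>k. k \<in> b \<Longrightarrow> r (\<mu> j) \<le> r (\<mu> k)"
    using b(1) ex_min_if_finite[of "(\<lambda>j. r (\<mu> j)) ` b"] by (auto simp: not_less)
  \<comment> \<open>The swap stays inside the group, so the new lender of \<open>j\<close> is the
    old lender of some member of \<open>b\<close> and has at least the base rate of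
    \<open>\<mu> j\<close>.\<close>
  have \<mu>': "\<mu>' j \<in> \<mu> ` b"
    using image j by blast
  then have "loan_rate r \<rho> S (\<mu> j) j \<le> loan_rate r \<rho> S (\<mu>' j) j"
    using b j least loan_rate_le_iff by auto
  moreover have "loan_rate r \<rho> S (\<mu>' j) j < loan_rate r \<rho> S (\<mu> j) j"
    using better b j \<mu>' by (metis strictly_prefers_lender_iff image_subset_iff subsetD imageI)
  ultimately show False
    by simp
qed

text \<open>Each rate condition excludes one deviation: \<open>affordable\<close> leaving the
  current lender, \<open>cheapest\<close> moving from it to an idle lender, \<open>unmatched\<close>
  an idle borrower approaching an idle lender. Weak inequalities suffice, since a deviation demands
  a strict gain.\<close>

lemma unilaterally_stable_contracting:
  assumes \<mu>: "is_matching N L B \<mu>"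
    and affordable: "\<forall>i\<in>L. \<forall>j\<in>B. \<mu> i = j \<longrightarrow> loan_rate r \<rho> S i j \<le> rbar j"
    and cheapest: "\<forall>i\<in>L. \<forall>j\<in>B. \<forall>k\<in>L. \<mu> i = j \<and> \<mu> k = k \<longrightarrow>
      loan_rate r \<rho> S i j \<le> loan_rate r \<rho> S k j"
    and unmatched: "\<forall>j\<in>B. \<forall>k\<in>L. \<mu> j = j \<and> \<mu> k = k \<longrightarrow> rbar j \<le> loan_rate r \<rho> S k j"
  shows "unilaterally_stable L B (contracting_preferences L B r rbar \<rho> S) \<mu>"
proof -
  \<comment> \<open>The rate conditions are indexed by the lender, stability by the borrower; the
    involution allows \<open>\<mu> j\<close> to be inserted for \<open>i\<close>.\<close>
  have matched: "\<mu> j \<in> L \<and> \<mu> (\<mu> j) = j" if "j \<in> B" "\<mu> j \<noteq> j" for j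
    using \<mu> that borrowers by (auto simp: is_matching_def)
  show ?thesis
    unfolding unilaterally_stable_def
  proof (intro conjI ballI impI notI; (elim bexE conjE)?)
    fix j
    assume "j \<in> B" "\<mu> j \<noteq> j"
      and "strictly_prefers (contracting_preferences L B r rbar \<rho> S) j j (\<mu> j)"
    then show False
      using matched affordable strictly_prefers_unmatched_iff(1) by (meson not_less)
  next
    fix j k
    assume jk: "j \<in> B" "k \<in> L" "\<mu> k = k"
      and better: "strictly_prefers (contracting_preferences L B r rbar \<rho> S) j k (\<mu> j)"
    show False
    proof (cases "\<mu> j = j")
      case True
      with jk better unmatched show False
        by (metis strictly_prefers_unmatched_iff(2) not_less)
    next
      case False
      with jk better cheapest matched show False
        by (meson strictly_prefers_lender_iff not_less)
    qed
  qed
qed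

lemma volume_le:
  assumes \<mu>: "is_matching N L B \<mu>"
  shows "volume L B \<mu> \<le> real (min (card B) (card L))"
proof -
  define L' B' where "L' = {l \<in> L. \<mu> l \<noteq> l}" and "B' = {b \<in> B. \<mu> b \<noteq> b}"
  have fin: "finite L" "finite B"
    using lenders borrowers finite_banks by (auto intro: finite_subset)
  have invol: "\<mu> (\<mu> a) = a" if "a \<in> L \<union> B" for a
    using \<mu> that lenders borrowers by (auto simp: is_matching_def)
  \<comment> \<open>As an involution, \<open>\<mu>\<close> serves as its own inverse.\<close>
  have "bij_betw \<mu> L' B'"
    using \<mu> invol
    by (intro bij_betwI[where g = \<mu>]) (auto simp: is_matching_def L'_def B'_def)
  then have eq: "card L' = card B'"
    by (rule bij_betw_same_card)
  have "(\<Sum>i\<in>L \<union> B. of_bool (\<mu> i \<noteq> i) :: real) =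
      (\<Sum>i\<in>L. of_bool (\<mu> i \<noteq> i)) + (\<Sum>i\<in>B. of_bool (\<mu> i \<noteq> i))"
    using fin disjoint by (rule sum.union_disjoint)
  also have "\<dots> = real (card L') + real (card B')"
    using fin by (simp add: sum_of_bool_eq L'_def B'_def Int_def)
  \<comment> \<open>The factor one half cancels against two equal cardinalities, so the volume can
    be read on either side of the market and is bounded by both.\<close>
  finally have "volume L B \<mu> = real (card L')" "volume L B \<mu> = real (card B')"
    using eq by (simp_all add: volume_def)
  moreover have "card L' \<le> card L" "card B' \<le> card B"
    using fin by (auto simp: L'_def B'_def intro: card_mono)
  ultimately show ?thesis
    by simp
qed

end

text \<open>The first two rate conditions concern matched pairs only, and the identity satisfies
  them vacuously; yet it is unstable once some loan rate lies below \<open>rbar j\<close>. The third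
  condition, on idle borrowers facing idle lenders, excludes such cases.\<close>

theorem proposition1:
  fixes N L B :: "'a set" and r rbar \<rho> :: "'a \<Rightarrow> real" and S :: nat
    and P :: "'a preferences"
  assumes "liquidity_market N L B r \<rho> S"
    and "P = contracting_preferences L B r rbar \<rho> S"
  shows "(\<forall>\<mu>. is_matching N L B \<mu> \<and>
              (\<forall>i\<in>L. \<forall>j\<in>B. \<mu> i = j \<longrightarrow> loan_rate r \<rho> S i j < rbar j) \<and>
              (\<forall>i\<in>L. \<forall>j\<in>B. \<forall>k\<in>L. \<mu> i = j \<and> \<mu> k = k \<longrightarrow>
                 loan_rate r \<rho> S i j < loan_rate r \<rho> S k j) \<and>
              (\<forall>j\<in>B. \<forall>k\<in>L. \<mu> j = j \<and> \<mu> k = k \<longrightarrow> rbar j \<le> loan_rate r \<rho> S k j)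
              \<longrightarrow> stable_matching N L B P \<mu>) \<and>
         (\<forall>\<mu>\<in>equilibria N L B P. volume L B \<mu> \<le> real (min (card B) (card L)))"
proof -
  interpret liquidity_market N L B r \<rho> S
    by fact
  show ?thesis
  proof (intro conjI allI impI ballI)
    fix \<mu>
    assume "is_matching N L B \<mu> \<and>
              (\<forall>i\<in>L. \<forall>j\<in>B. \<mu> i = j \<longrightarrow> loan_rate r \<rho> S i j < rbar j) \<and>
              (\<forall>i\<in>L. \<forall>j\<in>B. \<forall>k\<in>L. \<mu> i = j \<and> \<mu> k = k \<longrightarrow>
                 loan_rate r \<rho> S i j < loan_rate r \<rho> S k j) \<and>
              (\<forall>j\<in>B. \<forall>k\<in>L. \<mu> j = j \<and> \<mu> k = k \<longrightarrow> rbar j \<le> loan_rate r \<rho> S k j)"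
    then show "stable_matching N L B P \<mu>"
      unfolding stable_matching_def assms(2)
      by (intro conjI pairwise_stable_contracting coalition_stable_contracting
          unilaterally_stable_contracting) (auto intro: less_imp_le)
  next
    fix \<mu>
    assume "\<mu> \<in> equilibria N L B P"
    then show "volume L B \<mu> \<le> real (min (card B) (card L))"
      by (intro volume_le) (simp add: equilibria_def stable_matching_def)
  qed
qed

end
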